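(* Let $k\ge 0$ and $n\ge 3k+1$ be integers, and let $w$ be a composition of $n$. Then $w$ is uniquely determined by its set of $k$-deletions: if $w'$ is any composition whose set of $k$-deletions equals the set of $k$-deletions of $w$, then $w'=w$.
   Context: A composition is a finite word $w=w(1)w(2)\cdots w(m)$ whose letters are positive integers; it is a composition of $n$ if $w(1)+\cdots+w(m)=n$. A $1$-deletion of $w$ is a composition obtained from $w$ either by lowering an entry that is $\ge 2$ by $1$, or by removing an entry equal to $1$. For $k\ge 0$, the $k$-deletions of $w$ are defined recursively: the only $0$-deletion of $w$ is $w$ itself, and a $k$-deletion is a $1$-deletion of a $(k-1)$-deletion. Thus the $k$-deletions of a composition of $n$ are compositions of $n-k$. *)

theory Defs
  imports Main
begin

definition composition :: "nat list \<Rightarrow> bool" where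
  "composition w \<longleftrightarrow> (\<forall>x\<in>set w. 1 \<le> x)"

definition composition_of :: "nat \<Rightarrow> nat list \<Rightarrow> bool" where
  "composition_of n w \<longleftrightarrow> composition w \<and> sum_list w = n"

inductive one_deletion :: "nat list \<Rightarrow> nat list \<Rightarrow> bool" where
  lower: "2 \<le> x \<Longrightarrow> one_deletion (u @ x # v) (u @ (x - 1) # v)"
| remove: "one_deletion (u @ 1 # v) (u @ v)"

fun deletions :: "nat \<Rightarrow> nat list \<Rightarrow> nat list set" where
  "deletions 0 w = {w}"
| "deletions (Suc k) w = {v. \<exists>u\<in>deletions k w. one_deletion u v}"

end

theory Submission
  imports Defs "HOL-Library.Sublist"
begin

text \<open>
  The \<open>k\<close>-deletions of \<open>w\<close> are the compositions of \<open>n - k\<close> that embed into \<open>w\<close>, entry below entry, so it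
  suffices to separate two distinct compositions \<open>w\<close>, \<open>w'\<close> of \<open>n\<close> by a composition of size at most
  \<open>m = n - k \<ge> 2k + 1\<close> that embeds into only one of them. Call \<open>e = n - length w\<close> the excess of \<open>w\<close>.

  If the lengths differ, then \<open>1\<dots>1\<close> or, when both excesses are at most \<open>k\<close>, the word of all entries
  \<open>\<ge> 2\<close> separates. If the lengths agree, choose \<open>i\<close>, \<open>j\<close> with \<open>w i < w' i\<close> and \<open>w' j < w j\<close>. For \<open>e > k\<close>,
  raising the entry \<open>i\<close> of \<open>1\<dots>1\<close> to \<open>w i + 1\<close> (or \<open>j\<close> to \<open>w' j + 1\<close>) separates, unless \<open>e < 2k\<close> and
  \<open>e - k < w i \<le> k\<close>. In the remaining cases put \<open>t = w i + 1\<close>. If \<open>w\<close> and \<open>w'\<close> have different numbers of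
  entries \<open>\<ge> t\<close>, then some word \<open>t\<dots>t\<close> separates. If both have \<open>r\<close> of them, the positions of these
  entries differ, hence some initial segments of the same length contain different numbers of them,
  and this is seen by a word \<open>t\<dots>t1\<dots>1\<close> as well as by a word \<open>1\<dots>1t\<dots>t\<close>; their sizes add up to at
  most \<open>length w + t (r + 1) \<le> 2m + 1\<close>, so one of them has size at most \<open>m\<close>.
\<close>

section \<open>Containment of compositions and deletions\<close>

abbreviation contained :: "nat list \<Rightarrow> nat list \<Rightarrow> bool" where
  "contained \<equiv> list_emb (\<le>)"

lemma contained_refl: "contained w w"
  by (simp add: list_emb_refl)

lemma contained_trans: "contained u v \<Longrightarrow> contained v w \<Longrightarrow> contained u w"
  by (rule list_emb_trans) auto

lemma one_deletion_contained: "one_deletion w v \<Longrightarrow> contained v w"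
proof (induction rule: one_deletion.induct)
  case (lower x u v)
  then show ?case
    by (intro list_emb_append_mono contained_refl list_emb_Cons2) auto
next
  case (remove u v)
  show ?case
    by (intro list_emb_append_mono contained_refl list_emb_Cons)
qed

lemma one_deletion_sum_list: "one_deletion w v \<Longrightarrow> Suc (sum_list v) = sum_list w"
  by (induction rule: one_deletion.induct) auto

lemma one_deletion_composition: "one_deletion w v \<Longrightarrow> composition w \<Longrightarrow> composition v"
  by (induction rule: one_deletion.induct) (auto simp: composition_def)

lemma one_deletion_Cons:
  assumes "one_deletion w v"
  shows "one_deletion (x # w) (x # v)"
  using assms
proof cases
  case (lower y u v')
  then show ?thesis using one_deletion.lower[of y "x # u" v'] by simp
next
  case (remove u v')
  then show ?thesis using one_deletion.remove[of "x # u" v'] by simp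
qed

lemma one_deletion_head:
  assumes "1 \<le> y"
  shows "\<exists>v. one_deletion (y # ys) v \<and> contained ys v"
proof (cases "y = 1")
  case True
  then show ?thesis using one_deletion.remove[of "[]" ys] contained_refl by auto
next
  case False
  with assms have "one_deletion (y # ys) ((y - 1) # ys)"
    using one_deletion.lower[of y "[]" ys] by simp
  then show ?thesis using contained_refl by blast
qed

text \<open>The size gap shows up along the embedding as a skipped entry or a pair
  \<open>x < y\<close>; shrinking the first such entry of \<open>w\<close> by one leaves room for
  \<open>u\<close>.\<close>

lemma contained_imp_one_deletion:
  assumes "contained u w" "composition u" "composition w" "sum_list u < sum_list w"
  shows "\<exists>v. one_deletion w v \<and> contained u v"
  using assms
proof (induction rule: list_emb.induct)
  case (list_emb_Nil ys)
  then obtain y ys' where "ys = y # ys'" by (cases ys) auto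
  with list_emb_Nil one_deletion_head[of y ys'] show ?case by (auto simp: composition_def)
next
  case (list_emb_Cons xs ys y)
  then show ?case
    using one_deletion_head[of y ys] contained_trans by (auto simp: composition_def)
next
  case (list_emb_Cons2 x y xs ys)
  show ?case
  proof (cases "x = y")
    case True
    then obtain v where "one_deletion ys v" "contained xs v"
      using list_emb_Cons2 by (auto simp: composition_def)
    then show ?thesis using True one_deletion_Cons by blast
  next
    case False
    have "1 \<le> x" using list_emb_Cons2 by (auto simp: composition_def)
    then have "one_deletion (y # ys) ((y - 1) # ys)"
      using one_deletion.lower[of y "[]" ys] False list_emb_Cons2 by simp
    moreover have "contained (x # xs) ((y - 1) # ys)"
      using False list_emb_Cons2 by (intro list_emb.list_emb_Cons2) auto
    ultimately show ?thesis by blast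
  qed
qed

lemma deletions_contained: "v \<in> deletions k w \<Longrightarrow> contained v w"
  by (induction k arbitrary: v)
     (auto simp: contained_refl intro: contained_trans one_deletion_contained)

lemma deletions_sum_list: "v \<in> deletions k w \<Longrightarrow> sum_list v + k = sum_list w"
  by (induction k arbitrary: v) (fastforce dest: one_deletion_sum_list)+

lemma deletions_composition: "v \<in> deletions k w \<Longrightarrow> composition w \<Longrightarrow> composition v"
  by (induction k arbitrary: v) (auto intro: one_deletion_composition)

text \<open>Test words may be smaller than the \<open>k\<close>-deletions; iterating the single step
  still places them inside one.\<close>

lemma contained_imp_deletion:
  assumes "contained u w" "composition u" "composition w" "sum_list u + k \<le> sum_list w"
  shows "\<exists>v \<in> deletions k w. contained u v"
  using assms(4)
proof (induction k)
  case 0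
  then show ?case using assms by simp
next
  case (Suc k)
  then obtain v where v: "v \<in> deletions k w" "contained u v" by auto
  with Suc.prems deletions_sum_list[OF v(1)] deletions_composition[OF v(1)] assms
  obtain v' where "one_deletion v v'" "contained u v'"
    using contained_imp_one_deletion[of u v] by auto
  with v show ?case by auto
qed

section \<open>Excess and threshold counts\<close>

definition excess :: "nat list \<Rightarrow> nat" where
  "excess w = (\<Sum>x\<leftarrow>w. x - 1)"

lemma excess_plus_length: "composition w \<Longrightarrow> excess w + length w = sum_list w"
  by (induction w) (auto simp: excess_def composition_def)

lemma excess_mono: "contained u w \<Longrightarrow> excess u \<le> excess w"
  by (induction rule: list_emb.induct) (auto simp: excess_def)

lemma excess_ge_two_entries:
  assumes "i < length w" "j < length w" "i \<noteq> j"
  shows "(w ! i - 1) + (w ! j - 1) \<le> excess w"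
proof -
  have "(w ! i - 1) + (w ! j - 1) = (\<Sum>l\<in>{i, j}. w ! l - 1)"
    using assms by simp
  also have "\<dots> \<le> (\<Sum>l<length w. w ! l - 1)"
    using assms by (intro sum_mono2) auto
  also have "\<dots> = excess w"
    by (simp add: excess_def sum_list_sum_nth atLeast0LessThan)
  finally show ?thesis .
qed

definition count_ge :: "nat \<Rightarrow> nat list \<Rightarrow> nat" where
  "count_ge t w = length (filter (\<lambda>x. t \<le> x) w)"

lemma count_ge_simps [simp]:
  "count_ge t [] = 0"
  "count_ge t (x # w) = (if t \<le> x then Suc (count_ge t w) else count_ge t w)"
  "count_ge t (u @ v) = count_ge t u + count_ge t v"
  "count_ge t (replicate b t) = b"
  by (auto simp: count_ge_def)

lemma count_ge_mono: "contained u w \<Longrightarrow> count_ge t u \<le> count_ge t w"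
  by (induction rule: list_emb.induct) auto

lemma count_ge_excess: "count_ge (Suc x) w * x \<le> excess w"
  by (induction w) (auto simp: excess_def)

section \<open>Test words and what their containment detects\<close>

lemma replicate_contained_iff: "contained (replicate b t) w \<longleftrightarrow> b \<le> count_ge t w"
proof
  show "b \<le> count_ge t w" if "contained (replicate b t) w"
    using count_ge_mono[OF that, of t] by simp
  show "contained (replicate b t) w" if "b \<le> count_ge t w"
    using that
  proof (induction w arbitrary: b)
    case (Cons x w)
    then show ?case using Cons.IH[of b] by (cases b) (auto split: if_splits)
  qed simp
qed

lemma count_ge_1: "composition w \<Longrightarrow> count_ge 1 w = length w"
  by (induction w) (auto simp: composition_def)

lemma composition_replicate: "1 \<le> t \<Longrightarrow> composition (replicate b t)"
  by (auto simp: composition_def)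

lemma ones_contained_iff:
  "composition w \<Longrightarrow> contained (replicate a 1) w \<longleftrightarrow> a \<le> length w"
  by (simp add: replicate_contained_iff count_ge_1 del: One_nat_def)

text \<open>The ones consume at least \<open>a\<close> entries and, all entries being positive, fit
  on exactly the first \<open>a\<close>; the block of \<open>t\<close> is confined to the
  rest.\<close>

lemma ones_append_contained_iff:
  assumes "composition w" "a \<le> length w"
  shows "contained (replicate a 1 @ replicate b t) w \<longleftrightarrow> b \<le> count_ge t (drop a w)"
proof
  assume "contained (replicate a 1 @ replicate b t) w"
  then obtain us vs where w: "w = us @ vs" "contained (replicate a 1) us" "contained (replicate b t) vs"
    by (auto dest: list_emb_appendD)
  then have "a \<le> length us" using list_emb_length by fastforce
  with w show "b \<le> count_ge t (drop a w)" by (simp add: replicate_contained_iff)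
next
  assume b: "b \<le> count_ge t (drop a w)"
  have "composition (take a w)"
    using assms by (auto simp: composition_def dest: in_set_takeD)
  then have "contained (replicate a 1 @ replicate b t) (take a w @ drop a w)"
    using assms b by (intro list_emb_append_mono) 
      (simp_all add: replicate_contained_iff count_ge_1 del: One_nat_def)
  then show "contained (replicate a 1 @ replicate b t) w" by simp
qed

text \<open>Mirror image: the number of ones is chosen so that they can fill the last entries and
  confine the block to the first \<open>q\<close>.\<close>

lemma append_ones_contained_iff:
  assumes "composition w" "q \<le> length w"
  shows "contained (replicate b t @ replicate (length w - q) 1) w \<longleftrightarrow> b \<le> count_ge t (take q w)"
proof
  assume "contained (replicate b t @ replicate (length w - q) 1) w"
  then obtain us vs where w: "w = us @ vs" "contained (replicate b t) us"
      "contained (replicate (length w - q) 1) vs"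
    by (auto dest: list_emb_appendD)
  then have "length w - q \<le> length vs" using list_emb_length by fastforce
  with w assms have "length us \<le> q" by simp
  with w show "b \<le> count_ge t (take q w)" by (simp add: replicate_contained_iff)
next
  assume b: "b \<le> count_ge t (take q w)"
  have "composition (drop q w)"
    using assms by (auto simp: composition_def dest: in_set_dropD)
  then have "contained (replicate b t @ replicate (length w - q) 1) (take q w @ drop q w)"
    using assms b by (intro list_emb_append_mono) 
      (simp_all add: replicate_contained_iff count_ge_1 del: One_nat_def)
  then show "contained (replicate b t @ replicate (length w - q) 1) w" by simp
qed

lemma list_emb_same_length_iff:
  assumes "length u = length w"
  shows "list_emb P u w \<longleftrightarrow> list_all2 P u w"
proof
  assume "list_emb P u w"
  then show "list_all2 P u w" using assms
  proof (induction rule: list_emb.induct)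
    case (list_emb_Cons xs ys y)
    then show ?case using list_emb_length[of P xs ys] by simp
  qed auto
next
  assume "list_all2 P u w"
  then show "list_emb P u w" by (induction rule: list_all2_induct) auto
qed

text \<open>At full length no entry can be skipped, so the word probes the single entry
  \<open>i\<close>.\<close>

lemma ones_update_contained_iff:
  assumes "composition w" "i < length w"
  shows "contained ((replicate (length w) 1)[i := x]) w \<longleftrightarrow> x \<le> w ! i"
proof -
  have "1 \<le> w ! l" if "l < length w" for l
    using assms that by (auto simp: composition_def)
  then show ?thesis using assms
    by (auto simp: list_emb_same_length_iff list_all2_conv_all_nth nth_list_update)
qed

lemma sum_list_eq_imp_nth_less:
  fixes v w :: "nat list"
  assumes "sum_list v = sum_list w" "length v = length w" "v \<noteq> w"
  shows "\<exists>i<length w. v ! i < w ! i"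
proof (rule ccontr)
  assume "\<not> ?thesis"
  then have le: "w ! i \<le> v ! i" if "i \<in> {..<length w}" for i
    using that by (meson lessThan_iff not_less)
  have "(\<Sum>i<length w. w ! i) = (\<Sum>i<length w. v ! i)"
    using assms by (simp add: sum_list_sum_nth atLeast0LessThan)
  then have "w ! i = v ! i" if "i < length w" for i
    using sum_mono_inv[of "(!) w" "{..<length w}" "(!) v" i] le that by auto
  then have "v = w" using assms by (auto intro: nth_equalityI)
  with assms show False by simp
qed

section \<open>Compositions with the same small subcompositions\<close>

text \<open>For compositions of \<open>n\<close> this is what equal sets of
  \<open>k\<close>-deletions give, with \<open>m = n - k\<close>.\<close>

definition same_below :: "nat \<Rightarrow> nat list \<Rightarrow> nat list \<Rightarrow> bool" where
  "same_below m w w' \<longleftrightarrow>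
     (\<forall>u. composition u \<longrightarrow> sum_list u \<le> m \<longrightarrow> contained u w = contained u w')"

lemma same_belowD:
  "same_below m w w' \<Longrightarrow> contained u w \<Longrightarrow> composition u \<Longrightarrow> sum_list u \<le> m \<Longrightarrow> contained u w'"
  by (simp add: same_below_def)

lemma same_below_sym: "same_below m w w' \<Longrightarrow> same_below m w' w"
  by (simp add: same_below_def)

lemma deletions_subset_contained:
  assumes "deletions k w \<subseteq> deletions k w'" "composition w"
    and "contained u w" "composition u" "sum_list u + k \<le> sum_list w"
  shows "contained u w'"
  using contained_imp_deletion[OF assms(3,4,2,5)] assms(1) deletions_contained contained_trans
  by blast

lemma excess_filter_ge_2: "excess (filter (\<lambda>x. 2 \<le> x) w) = excess w"
  by (induction w) (auto simp: excess_def)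

lemma sum_list_filter_ge_2: "sum_list (filter (\<lambda>x. 2 \<le> x) w) \<le> 2 * excess w"
  by (induction w) (auto simp: excess_def)

lemma filter_contained: "contained (filter P w) w"
  by (induction w) auto

lemma same_below_length_le:
  assumes "same_below m w w'" "composition w" "composition w'"
    and "sum_list w = m + k" "sum_list w' = m + k" "2 * k + 1 \<le> m"
  shows "length w' \<le> length w"
proof (rule ccontr)
  assume "\<not> ?thesis"
  then have less: "length w < length w'" by simp
  show False
  proof (cases "length w < m")
    case True
    have "contained (replicate (Suc (length w)) 1) w'"
      using ones_contained_iff[of w' "Suc (length w)"] assms less by simp
    then have "contained (replicate (Suc (length w)) 1) w"
      using True
      by (intro same_belowD[OF same_below_sym[OF assms(1)]])
         (auto simp: composition_def sum_list_replicate)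
    then show False
      using ones_contained_iff[of w "Suc (length w)"] assms by simp
  next
    case False
    let ?u = "filter (\<lambda>x. 2 \<le> x) w"
    \<comment> \<open>Length at least \<open>m\<close> leaves excess at most \<open>k\<close>, and
      the longer \<open>w'\<close> of the same sum has smaller excess.\<close>
    have ex: "excess w' < excess w" "excess w \<le> k"
      using excess_plus_length[of w] excess_plus_length[of w'] assms less False by linarith+
    have "contained ?u w'"
    proof (rule same_belowD[OF assms(1) filter_contained])
      show "composition ?u" by (auto simp: composition_def)
      \<comment> \<open>An entry \<open>y \<ge> 2\<close> is at most \<open>2 * (y - 1)\<close>, so
        the size is at most \<open>2 * k < m\<close>.\<close>
      show "sum_list ?u \<le> m"
        using sum_list_filter_ge_2[of w] ex assms by linarith
    qed
    then show False
      using excess_mono[of ?u w'] ex by (simp add: excess_filter_ge_2)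
  qed
qed

lemma same_below_count_ge_le:
  assumes "same_below m w w'" "1 \<le> t" "t * Suc (count_ge t w) \<le> m"
  shows "count_ge t w' \<le> count_ge t w"
proof (rule ccontr)
  assume "\<not> ?thesis"
  then have "contained (replicate (Suc (count_ge t w)) t) w'"
    unfolding replicate_contained_iff by simp
  then have "contained (replicate (Suc (count_ge t w)) t) w"
    using assms
    by (intro same_belowD[OF same_below_sym[OF assms(1)] _ composition_replicate])
       (simp_all add: sum_list_replicate algebra_simps)
  then show False unfolding replicate_contained_iff by simp
qed

lemma same_below_count_ge_take_le:
  assumes same: "same_below m w w'" and comp: "composition w" "composition w'"
    and len: "length w' = length w" and cnt: "count_ge t w' = count_ge t w"
    and t: "1 \<le> t" "length w + t * Suc (count_ge t w) \<le> 2 * m + 1"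
    and q: "q \<le> length w"
  shows "count_ge t (take q w) \<le> count_ge t (take q w')"
proof (rule ccontr)
  define c c' r where "c = count_ge t (take q w)" and "c' = count_ge t (take q w')"
    and "r = count_ge t w"
  assume "\<not> ?thesis"
  then have less: "c' < c" by (simp add: c_def c'_def)
  have drop: "count_ge t (drop q w) = r - c" "count_ge t (drop q w') = r - c'" "c \<le> r" "c' \<le> r"
    using count_ge_simps(3)[of t "take q w" "drop q w"]
      count_ge_simps(3)[of t "take q w'" "drop q w'"] cnt
    by (simp_all add: c_def c'_def r_def)
  \<comment> \<open>\<open>?u\<close> asks for more large entries among the first \<open>q\<close>
    than \<open>w'\<close> has. As the totals agree, \<open>w\<close> has fewer after position
    \<open>q\<close>, and \<open>?v\<close> asks for one more than that.\<close>
  let ?u = "replicate (Suc c') t @ replicate (length w - q) 1"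
  let ?v = "replicate q 1 @ replicate (Suc (r - c)) t"
  have comp_uv: "composition ?u" "composition ?v"
    using t by (auto simp: composition_def)
  have u: "contained ?u w" "\<not> contained ?u w'"
    using append_ones_contained_iff[OF comp(1) q, of "Suc c'" t]
      append_ones_contained_iff[OF comp(2), of q "Suc c'" t] q len less
    unfolding c_def[symmetric] c'_def[symmetric] by auto
  have v: "contained ?v w'" "\<not> contained ?v w"
    using ones_append_contained_iff[OF comp(1) q, of "Suc (r - c)" t]
      ones_append_contained_iff[OF comp(2), of q "Suc (r - c)" t] q len less drop
    by auto
  have "m < sum_list ?u" "m < sum_list ?v"
    using same_belowD[OF same u(1) comp_uv(1)] u(2)
      same_belowD[OF same_below_sym[OF same] v(1) comp_uv(2)] v(2) by (auto simp: not_le[symmetric])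
  then have "2 * m + 2 \<le> sum_list ?u + sum_list ?v" by linarith
  also have "\<dots> = length w + t * (Suc c' + Suc (r - c))"
    using q by (simp add: sum_list_replicate algebra_simps)
  \<comment> \<open>From \<open>c' < c\<close>, the two blocks together have at most
    \<open>r + 1\<close> letters.\<close>
  also have "\<dots> \<le> length w + t * Suc r"
    using less drop by (intro add_left_mono mult_left_mono) auto
  finally show False using t by (simp add: r_def)
qed

text \<open>By symmetry all prefix counts agree; those for \<open>i\<close> and \<open>Suc i\<close>
  reveal whether entry \<open>i\<close> reaches \<open>t\<close>.\<close>

lemma same_below_nth_ge:
  assumes "same_below m w w'" "composition w" "composition w'"
    and "length w' = length w" "count_ge t w' = count_ge t w"
    and "1 \<le> t" "length w + t * Suc (count_ge t w) \<le> 2 * m + 1"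
    and i: "i < length w"
  shows "t \<le> w ! i \<longleftrightarrow> t \<le> w' ! i"
proof -
  have eq: "count_ge t (take q w) = count_ge t (take q w')" if "q \<le> length w" for q
    using same_below_count_ge_take_le[of m w w' t q]
      same_below_count_ge_take_le[of m w' w t q] same_below_sym that assms
    by (auto intro!: antisym)
  show ?thesis
    using eq[of i] eq[of "Suc i"] i assms(4)
    by (auto simp: take_Suc_conv_app_nth split: if_splits)
qed

text \<open>Ones with entry \<open>i\<close> raised to \<open>Suc (w ! i)\<close> embed only into
  \<open>w'\<close>, so their size \<open>length w + w ! i\<close> must exceed
  \<open>m\<close>.\<close>

lemma same_below_nth_gt_excess:
  assumes "same_below m w w'" "composition w" "composition w'" "length w' = length w"
    and "i < length w" "w ! i < w' ! i"
  shows "m < length w + w ! i"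
proof (rule ccontr)
  assume small: "\<not> ?thesis"
  let ?u = "(replicate (length w) 1)[i := Suc (w ! i)]"
  have "contained ?u w'"
    using ones_update_contained_iff[of w' i "Suc (w ! i)"] assms by simp
  then have "contained ?u w"
  proof (rule same_belowD[OF same_below_sym[OF assms(1)]])
    have "set ?u \<subseteq> insert (Suc (w ! i)) (set (replicate (length w) 1))"
      by (rule set_update_subset_insert)
    then show "composition ?u" by (auto simp: composition_def split: if_splits)
    show "sum_list ?u \<le> m"
      using small assms by (simp add: sum_list_update sum_list_replicate)
  qed
  then show False
    using ones_update_contained_iff[of w i "Suc (w ! i)"] assms by simp
qed

section \<open>Size estimates for the separating words\<close>

text \<open>\<open>B\<close> and \<open>r\<close> count entries \<open>> x\<close> of a composition with excess \<open>e\<close>; the last hypothesis is what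
  the words of full length leave open.\<close>

lemma constant_word_size_le:
  fixes B x e k m :: nat
  assumes "B * x \<le> e" "1 \<le> x" "2 * k + 1 \<le> m"
    and "k < e \<Longrightarrow> e - k < x \<and> x \<le> k \<and> e < 2 * k"
  shows "Suc x * B \<le> m"
proof (cases "e \<le> k")
  case True
  have "B \<le> B * x" using assms by simp
  moreover have "Suc x * B = B + B * x" by simp
  ultimately show ?thesis using True assms by linarith
next
  case False
  define d where "d = e - k"
  have d: "e = k + d" "1 \<le> d" "d < x" "d < k" using False assms by (auto simp: d_def)
  obtain f where f: "k = d + Suc f" using d(4) less_iff_Suc_add by auto
  show ?thesis
  proof (rule ccontr)
    assume "\<not> ?thesis"
    then have "2 * k + 2 \<le> B * x + B" using assms by (simp add: algebra_simps)
    \<comment> \<open>Subtracting \<open>B * x \<le> k + d\<close> leaves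
      \<open>B \<ge> k - d + 2 = f + 3\<close>. As \<open>x > d\<close>, \<open>B * x\<close> is at
      least \<open>(f + 3) * (d + 1)\<close>, which exceeds
      \<open>e = 2 * d + f + 1\<close>.\<close>
    then have "f + 3 \<le> B" using assms(1) d(1) f by linarith
    then have "(f + 3) * Suc d \<le> B * x" using d by (intro mult_mono) auto
    moreover have "f \<le> f * d" using d by simp
    ultimately show False using assms(1) d(1,2) f by (simp add: algebra_simps)
  qed
qed

text \<open>Rests on \<open>a + b \<le> a * b + 1\<close> for positive \<open>a\<close>,
  \<open>b\<close>: with \<open>r\<close>, \<open>x\<close> if \<open>e \<le> k\<close>, and with
  \<open>r - 1\<close>, \<open>x\<close> if \<open>e > k\<close> and \<open>r \<ge> 2\<close>, where
  \<open>r * x \<le> e < k + x\<close> gives \<open>(r - 1) * x < k\<close>. For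
  \<open>r = 1\<close> and \<open>e > k\<close>, \<open>x \<le> k\<close> suffices.\<close>

lemma count_plus_threshold_le:
  fixes r x e k :: nat
  assumes "r * x \<le> e" "1 \<le> r" "1 \<le> x"
    and "k < e \<Longrightarrow> e - k < x \<and> x \<le> k \<and> e < 2 * k"
  shows "r + x \<le> Suc k"
proof -
  obtain r' x' where rx: "r = Suc r'" "x = Suc x'"
    using assms by (metis Suc_le_D One_nat_def)
  show ?thesis
  proof (cases "e \<le> k")
    case True
    with assms rx show ?thesis by simp
  next
    case False
    show ?thesis
    proof (cases r')
      case 0
      with False assms rx show ?thesis by simp
    next
      case (Suc r'')
      obtain x'' where "x' = Suc x''" using False assms rx by (cases x') auto
      with Suc False assms rx show ?thesis by simp
    qed
  qed
qed

section \<open>Combining the separating words\<close>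

lemma same_below_imp_eq:
  assumes same: "same_below m w w'" and comp: "composition w" "composition w'"
    and sum: "sum_list w = m + k" "sum_list w' = m + k" and m: "2 * k + 1 \<le> m"
  shows "w' = w"
proof (rule ccontr)
  assume neq: "w' \<noteq> w"
  have len: "length w' = length w"
    using same_below_length_le[of m w w' k] same_below_length_le[of m w' w k]
      same_below_sym assms by (auto intro!: antisym)
  define e where "e = excess w"
  have e: "e + length w = m + k" "excess w' = e"
    using excess_plus_length[OF comp(1)] excess_plus_length[OF comp(2)] sum len
    by (simp_all add: e_def)
  obtain i where i: "i < length w" "w ! i < w' ! i"
    using sum_list_eq_imp_nth_less[of w w'] sum len neq by auto
  obtain j where j: "j < length w" "w' ! j < w ! j"
    using sum_list_eq_imp_nth_less[of w' w] sum len neq by auto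
  define x where "x = w ! i"
  have x: "1 \<le> x" using comp(1) i by (auto simp: x_def composition_def)
  have mid: "e - k < x \<and> x \<le> k \<and> e < 2 * k" if "k < e"
  proof -
    have "m < length w + x"
      using same_below_nth_gt_excess[OF same comp len i] by (simp add: x_def)
    moreover have "m < length w + w' ! j"
      using same_below_nth_gt_excess[OF same_below_sym[OF same] comp(2,1) len[symmetric]] j len
      by simp
    \<comment> \<open>\<open>i\<close> and \<open>j\<close> differ and \<open>x < w' ! i\<close>, so
      both terms draw on the excess of \<open>w'\<close>. Since \<open>w' ! j\<close> exceeds
      \<open>e - k\<close>, this forces \<open>x \<le> k\<close>.\<close>
    moreover have "x + (w' ! j - 1) \<le> e"
      using excess_ge_two_entries[of i w' j] i j len e by (cases "i = j") (auto simp: x_def)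
    ultimately show ?thesis using e that by linarith
  qed
  have small: "Suc x * B \<le> m" if "B * x \<le> e" for B
    using constant_word_size_le[OF that x m] mid by blast
  have bound: "count_ge (Suc x) w * x \<le> e" "count_ge (Suc x) w' * x \<le> e"
    using count_ge_excess[of x w] count_ge_excess[of x w'] e by (simp_all add: e_def)
  have le: "count_ge (Suc x) v' \<le> count_ge (Suc x) v"
    if "same_below m v v'" "count_ge (Suc x) v' * x \<le> e" for v v'
  proof (rule ccontr)
    assume less: "\<not> ?thesis"
    then have "Suc (count_ge (Suc x) v) * x \<le> count_ge (Suc x) v' * x"
      by (intro mult_right_mono) auto
    then have "Suc x * Suc (count_ge (Suc x) v) \<le> m"
      using that by (intro small) linarith
    then show False
      using same_below_count_ge_le[OF that(1), of "Suc x"] less by simp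
  qed
  have cnt: "count_ge (Suc x) w' = count_ge (Suc x) w"
    using le[OF same bound(2)] le[OF same_below_sym[OF same] bound(1)] by simp
  define r where "r = count_ge (Suc x) w"
  have "w' ! i \<in> set (filter (\<lambda>y. Suc x \<le> y) w')"
    using i len by (simp add: x_def)
  then have "0 < count_ge (Suc x) w'"
    unfolding count_ge_def by (rule length_pos_if_in_set)
  then have "1 \<le> r" using cnt by (simp add: r_def)
  then have "r + x \<le> Suc k"
    using count_plus_threshold_le[of r x e k] bound x mid by (simp add: r_def)
  moreover have "length w + r * x \<le> m + k" using e bound by (simp add: r_def)
  \<comment> \<open>The left side is \<open>(length w + r * x) + (r + x) + 1\<close>, at most
    \<open>(m + k) + (k + 1) + 1\<close>.\<close>
  ultimately have "length w + Suc x * Suc (count_ge (Suc x) w) \<le> 2 * m + 1"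
    using m by (simp add: r_def[symmetric] algebra_simps)
  then have "Suc x \<le> w ! i \<longleftrightarrow> Suc x \<le> w' ! i"
    using same_below_nth_ge[OF same comp len cnt _ _ i(1)] by simp
  then show False using i by (simp add: x_def)
qed

theorem theorem1:
  fixes k n :: nat and w w' :: "nat list"
  assumes "n \<ge> 3 * k + 1"
    and "composition_of n w"
    and "composition w'"
    and "deletions k w' = deletions k w"
  shows "w' = w"
proof -
  have w: "composition w" "sum_list w = n"
    using assms(2) by (auto simp: composition_of_def)
  \<comment> \<open>A common deletion \<open>v\<close> fixes the size of \<open>w'\<close>: both
    sums are \<open>sum_list v + k\<close>. One exists because the empty word embeds into
    \<open>w\<close>.\<close>
  obtain v where "v \<in> deletions k w"
    using contained_imp_deletion[of "[]" w k] w assms(1) by (auto simp: composition_def)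
  then have w': "sum_list w' = n"
    using deletions_sum_list[of v k w] deletions_sum_list[of v k w'] w assms(4) by simp
  have "same_below (n - k) w w'"
    unfolding same_below_def
    using deletions_subset_contained[of k w w'] deletions_subset_contained[of k w' w] w w' assms
    by auto
  then show ?thesis
    using same_below_imp_eq[of "n - k" w w' k] w w' assms by simp
qed

end
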